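(* $gr^3_2(B_7)=12$.
   Context: $K_n$ is the complete graph of order $n$. The book $B_n:=K_2+nK_1$ (graph join) is the graph on $n+2$ vertices consisting of an edge $xy$ (the spine) together with $n$ further, pairwise non-adjacent vertices (the pages), each adjacent to both $x$ and $y$. A $t$-coloring of $K_p$ is a map $f:E(K_p)\to\{1,\dots,t\}$, not assumed surjective. A Gallai $t$-coloring is a $t$-coloring with no rainbow triangle, i.e. there are no three vertices $x,y,z$ such that $f(xy),f(xz),f(yz)$ are pairwise distinct. For $1\le s<t$ and a graph $G$, the weakened Gallai-Ramsey number $gr^t_s(G)$ is the least $p\in\mathbb{N}$ such that every Gallai $t$-coloring of $K_p$ contains a (not necessarily induced) subgraph isomorphic to $G$ whose edges use at most $s$ colors. *)

theory Defs
  imports Main "HOL-Library.FuncSet"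
begin

record 'a ugraph =
  verts :: "'a set"
  edges :: "'a set set"

definition two_subsets :: "'a set \<Rightarrow> 'a set set" where
  "two_subsets V = {e. e \<subseteq> V \<and> card e = 2}"

definition simple_graph :: "'a ugraph \<Rightarrow> bool" where
  "simple_graph G \<longleftrightarrow> edges G \<subseteq> two_subsets (verts G)"

definition complete :: "nat \<Rightarrow> nat ugraph" where
  "complete n = \<lparr>verts = {..<n}, edges = two_subsets {..<n}\<rparr>"

text \<open>The disjoint union of \<open>n\<close> copies of \<open>G\<close>, written \<open>nG\<close>.\<close>
definition copies :: "nat \<Rightarrow> 'a ugraph \<Rightarrow> (nat \<times> 'a) ugraph" where
  "copies n G = \<lparr>verts = {..<n} \<times> verts G,
                 edges = {Pair i ` e |i e. i < n \<and> e \<in> edges G}\<rparr>"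

definition graph_join :: "'a ugraph \<Rightarrow> 'b ugraph \<Rightarrow> ('a + 'b) ugraph" where
  "graph_join G H = \<lparr>verts = verts G <+> verts H,
     edges = (`) Inl ` edges G \<union> (`) Inr ` edges H
             \<union> {{Inl u, Inr v} |u v. u \<in> verts G \<and> v \<in> verts H}\<rparr>"

definition book :: "nat \<Rightarrow> (nat + nat \<times> nat) ugraph" where
  "book n = graph_join (complete 2) (copies n (complete 1))"

definition subgraph :: "'a ugraph \<Rightarrow> 'a ugraph \<Rightarrow> bool" where
  "subgraph H G \<longleftrightarrow> simple_graph H \<and> verts H \<subseteq> verts G \<and> edges H \<subseteq> edges G"

definition isomorphic :: "'a ugraph \<Rightarrow> 'b ugraph \<Rightarrow> bool" where
  "isomorphic G H \<longleftrightarrow>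
     (\<exists>\<phi>. bij_betw \<phi> (verts G) (verts H) \<and>
          (\<forall>u\<in>verts G. \<forall>v\<in>verts G. {u, v} \<in> edges G \<longleftrightarrow> {\<phi> u, \<phi> v} \<in> edges H))"

text \<open>Only the values of a coloring on the edges of \<open>K\<^sub>p\<close> are relevant.\<close>
definition coloring :: "nat \<Rightarrow> nat \<Rightarrow> (nat set \<Rightarrow> nat) \<Rightarrow> bool" where
  "coloring t p f \<longleftrightarrow> f \<in> edges (complete p) \<rightarrow> {1..t}"

definition rainbow_triangle :: "nat \<Rightarrow> (nat set \<Rightarrow> nat) \<Rightarrow> nat \<Rightarrow> nat \<Rightarrow> nat \<Rightarrow> bool" where
  "rainbow_triangle p f x y z \<longleftrightarrow>
     {x, y, z} \<subseteq> verts (complete p) \<and> distinct [x, y, z] \<and>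
     distinct [f {x, y}, f {x, z}, f {y, z}]"

definition gallai_coloring :: "nat \<Rightarrow> nat \<Rightarrow> (nat set \<Rightarrow> nat) \<Rightarrow> bool" where
  "gallai_coloring t p f \<longleftrightarrow> coloring t p f \<and> (\<nexists>x y z. rainbow_triangle p f x y z)"

text \<open>The weakened Gallai-Ramsey number \<open>gr\<^sup>t\<^sub>s(G)\<close>, intended for \<open>1 \<le> s < t\<close>.
  If no suitable \<open>p\<close> existed, the value of \<open>LEAST\<close> would be unspecified.\<close>
definition gr :: "nat \<Rightarrow> nat \<Rightarrow> 'a ugraph \<Rightarrow> nat" where
  "gr t s G = (LEAST p. \<forall>f. gallai_coloring t p f \<longrightarrow>
     (\<exists>H. subgraph H (complete p) \<and> isomorphic G H \<and> card (f ` edges H) \<le> s))"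

end

theory Submission imports Defs "HOL-Library.Disjoint_Sets" begin

text \<open>A copy of \<open>B\<^sub>n\<close> avoiding colour \<open>c\<close> is an edge \<open>xy\<close> not of colour \<open>c\<close> together with
  \<open>n\<close> vertices to which neither \<open>x\<close> nor \<open>y\<close> sends colour \<open>c\<close>. So in a bad colouring of
  \<open>K\<^bsub>12\<^esub>\<close> the \<open>c\<close>-neighbourhoods of the ends of any edge not of colour \<open>c\<close> cover at least
  four vertices.

  In a Gallai 3-colouring some colour is disconnected, and its components are pairwise joined in
  a single colour. Hence either the vertex set splits in two parts joined in one colour, or there
  are at least four components of colour \<open>c\<close>. In the latter case degree counting forces four
  \<open>c\<close>-coloured triangles, and one of the other two colours then joins a fixed triangle to at
  most one of the remaining three. In the former case the parts have sizes 6 and 6, contradicting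
  R(3,3) = 6, or 1 and 11; then the same dichotomy applied to the 11 vertices ends
  either at once or with blocks of sizes 3, 3, 3, 2, which are excluded in the same way.\<close>

section \<open>Gallai partitions for three colours\<close>

lemma partition_on_block:
  assumes "partition_on V P" "A \<in> P"
  shows "A \<subseteq> V" "A \<noteq> {}"
  using assms by (auto simp: partition_on_def)

lemma partition_on_disjoint_blocks:
  "partition_on V P \<Longrightarrow> A \<in> P \<Longrightarrow> B \<in> P \<Longrightarrow> A \<noteq> B \<Longrightarrow> A \<inter> B = {}"
  by (auto simp: partition_on_def disjoint_def)

lemma partition_on_ex_block: "partition_on V P \<Longrightarrow> x \<in> V \<Longrightarrow> \<exists>A\<in>P. x \<in> A"
  by (auto simp: partition_on_def)

text \<open>Binary functions on an arbitrary finite set restrict to one side of a split or to a set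
  with a vertex removed.\<close>

locale gallai3 =
  fixes V :: "'a set" and g :: "'a \<Rightarrow> 'a \<Rightarrow> nat"
  assumes fin: "finite V"
    and sym: "g x y = g y x"
    and col: "x \<in> V \<Longrightarrow> y \<in> V \<Longrightarrow> x \<noteq> y \<Longrightarrow> g x y \<in> {1, 2, 3}"
    and no_rainbow: "x \<in> V \<Longrightarrow> y \<in> V \<Longrightarrow> z \<in> V \<Longrightarrow> distinct [x, y, z] \<Longrightarrow>
      g x y = g x z \<or> g x y = g y z \<or> g x z = g y z"
begin

lemma gallai3_subset: "W \<subseteq> V \<Longrightarrow> gallai3 W g"
  using fin sym col no_rainbow unfolding gallai3_def
  by (meson finite_subset subsetD)

text \<open>A Gallai partition whose quotient avoids \<open>c\<close>, so only two colours remain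
  between blocks; all pigeonhole arguments on blocks use this.\<close>

definition blocks :: "nat \<Rightarrow> 'a set set \<Rightarrow> bool" where
  "blocks c P \<longleftrightarrow> partition_on V P \<and> card P \<ge> 2 \<and>
     (\<forall>A\<in>P. \<forall>x\<in>A. \<forall>y\<in>V - A. g x y \<noteq> c) \<and>
     (\<forall>A\<in>P. \<forall>B\<in>P. A \<noteq> B \<longrightarrow> (\<exists>d. \<forall>x\<in>A. \<forall>y\<in>B. g x y = d))"

text \<open>The blocks are the components of the graph of colour \<open>c\<close>: a \<open>c\<close>-edge \<open>xx'\<close> forces
  \<open>xy\<close> and \<open>x'y\<close> to have the same colour for every \<open>y\<close> outside its component.\<close>
lemma ex_blocks:
  assumes S: "S \<noteq> {}" "S \<subset> V" and cut: "\<forall>x\<in>S. \<forall>y\<in>V - S. g x y \<noteq> c"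
  shows "\<exists>P. blocks c P"
proof -
  define E where "E = {(x, y). x \<in> V \<and> y \<in> V \<and> g x y = c}"
  define R where "R = E\<^sup>* \<inter> V \<times> V"
  have symE: "sym E" unfolding E_def sym_def using sym by auto
  have eq: "equiv V R"
  proof (rule equivI)
    show "refl_on V R" unfolding R_def refl_on_def by auto
    show "sym R" unfolding R_def using sym_rtrancl[OF symE] by (auto simp: sym_def)
    show "trans R" unfolding R_def using trans_rtrancl[of E] by (auto simp: trans_def)
  qed (auto simp: R_def)
  have part: "partition_on V (V // R)"
    by (rule partition_on_quotient[OF eq])
  have ER: "(x, y) \<in> R" if "x \<in> V" "y \<in> V" "g x y = c" for x y
    using that unfolding R_def E_def by auto
  have hom: "g x y = g x' y" if "(x, x') \<in> E\<^sup>*" "y \<in> V" "x \<in> V" "(x, y) \<notin> E\<^sup>*" for x x' y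
    using that(1)
  proof (induction rule: rtrancl_induct)
    case base show ?case ..
  next
    case (step u w)
    have wV: "w \<in> V" "u \<in> V" "g u w = c" using step.hyps(2) by (auto simp: E_def)
    have xw: "(x, w) \<in> E\<^sup>*" using step.hyps by auto
    have ne: "u \<noteq> y" "w \<noteq> y" using step.hyps(1) xw that(4) by auto
    \<comment> \<open>Otherwise \<open>y\<close> would join the component of \<open>x\<close>. So
      \<open>uw\<close> is the only edge of colour \<open>c\<close> in the triangle
      \<open>u, w, y\<close>, and the other two agree. The case \<open>u = w\<close> arises because
      \<open>E\<close> may contain loops.\<close>
    have "g u y \<noteq> c" "g w y \<noteq> c"
      using step.hyps(1) xw that(2,4) wV by (auto simp: E_def dest: rtrancl_into_rtrancl)
    then have "g u y = g w y"
      using no_rainbow[of u w y] wV that(2) ne by (cases "u = w") auto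
    then show ?case using step.IH by simp
  qed
  have sep: "g x y = g x' y'" if "A \<in> V // R" "B \<in> V // R" "A \<noteq> B" "x \<in> A" "x' \<in> A" "y \<in> B" "y' \<in> B"
    for A B x x' y y'
  proof -
    have V: "x \<in> V" "x' \<in> V" "y \<in> V" "y' \<in> V"
      using partition_on_block(1)[OF part] that by blast+
    have 1: "(x, x') \<in> R" "(y, y') \<in> R" "(x, y) \<notin> R" "(x', y) \<notin> R"
      using that quotient_eq_iff[OF eq] by blast+
    have "(y, x') \<notin> R" using 1(4) eq by (auto simp: equiv_def sym_def)
    \<comment> \<open>\<open>hom\<close> moves only the first end of an edge; reversing the edge
      lets it move the other.\<close>
    have "g x y = g x' y" using hom[of x x' y] 1 V unfolding R_def by auto
    also have "\<dots> = g y x'" by (rule sym)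
    also have "\<dots> = g y' x'" using hom[of y y' x'] 1 \<open>(y, x') \<notin> R\<close> V unfolding R_def by auto
    also have "\<dots> = g x' y'" by (rule sym)
    finally show ?thesis .
  qed
  have nocol: "g x y \<noteq> c" if "A \<in> V // R" "x \<in> A" "y \<in> V - A" for A x y
  proof
    assume gxy: "g x y = c"
    have "x \<in> V" using partition_on_block(1)[OF part] that by blast
    then have "(x, y) \<in> R" using ER that gxy by auto
    then show False using that in_quotient_imp_closed[OF eq] by blast
  qed
  have fP: "finite (V // R)"
    using finite_quotient[OF fin, of R] eq by (auto simp: equiv_def R_def)
  obtain s t where st: "s \<in> S" "t \<in> V" "t \<notin> S" using S by blast
  \<comment> \<open>No \<open>c\<close>-path leaves \<open>S\<close>, so \<open>s\<close> and
    \<open>t\<close> lie in different classes and there are at least two blocks.\<close>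
  have inS: "u \<in> S" if "(s, u) \<in> E\<^sup>*" for u
    using that
  proof (induction rule: rtrancl_induct)
    case base show ?case by (rule st)
  next
    case (step u w)
    then show ?case using cut by (auto simp: E_def)
  qed
  have "(s, t) \<notin> R" using inS st unfolding R_def by auto
  moreover have "s \<in> V" using st S by auto
  ultimately have "R `` {s} \<noteq> R `` {t}" using eq_equiv_class[OF _ eq st(2)] by auto
  then have "card {R `` {s}, R `` {t}} = 2" by simp
  moreover have "{R `` {s}, R `` {t}} \<subseteq> V // R" using \<open>s \<in> V\<close> st by (auto intro: quotientI)
  ultimately have "card (V // R) \<ge> 2" using card_mono[OF fP] by metis
  moreover have "\<exists>d. \<forall>x\<in>A. \<forall>y\<in>B. g x y = d" if AB: "A \<in> V // R" "B \<in> V // R" "A \<noteq> B" for A B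
  proof -
    obtain a b where "a \<in> A" "b \<in> B"
      using partition_on_block(2)[OF part] AB by blast
    then show ?thesis using sep[OF AB] by blast
  qed
  ultimately show ?thesis unfolding blocks_def using part nocol by blast
qed

end

section \<open>Disconnected colours and monochromatic splits\<close>

lemma third_colour: "\<exists>c\<in>{1, 2, 3::nat}. c \<noteq> a \<and> c \<noteq> b"
  by (cases "a = 1 \<or> b = 1"; cases "a = 2 \<or> b = 2") auto

text \<open>Induction on the vertices: a colour disconnected on \<open>W\<close> stays so after
  adding \<open>v\<close>, or another colour takes over.\<close>

lemma gallai3_ex_cut:
  assumes "gallai3 V g" "card V \<ge> 2"
  shows "\<exists>c\<in>{1, 2, 3}. \<exists>S. S \<noteq> {} \<and> S \<subset> V \<and> (\<forall>x\<in>S. \<forall>y\<in>V - S. g x y \<noteq> c)"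
proof -
  have "finite V" using assms(1) by (simp add: gallai3_def)
  then show ?thesis using assms
  proof (induction V rule: finite_induct)
    case empty then show ?case by simp
  next
    case (insert v W)
    interpret V: gallai3 "insert v W" g by fact
    show ?case
    proof (cases "card W \<ge> 2")
      case False
      then obtain w where W: "W = {w}"
        using insert.prems(2) insert.hyps by (auto simp: not_le less_2_cases_iff card_1_singleton_iff)
      obtain c where "c \<in> {1, 2, 3}" "c \<noteq> g v w" using third_colour by blast
      then show ?thesis using W insert.hyps(2) by (intro bexI[of _ c] exI[of _ "{v}"]) auto
    next
      case True
      have gW: "gallai3 W g" using V.gallai3_subset by auto
      then interpret W: gallai3 W g .
      from insert.IH[OF gW True] obtain c S where c: "c \<in> {1, 2, 3}"
        and S: "S \<noteq> {}" "S \<subset> W" "\<forall>x\<in>S. \<forall>y\<in>W - S. g x y \<noteq> c" by blast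
      obtain P where "W.blocks c P" using W.ex_blocks[OF S] ..
      then have part: "partition_on W P" and P2: "card P \<ge> 2"
        and nocol: "\<And>A x y. A \<in> P \<Longrightarrow> x \<in> A \<Longrightarrow> y \<in> W - A \<Longrightarrow> g x y \<noteq> c"
        and hom: "\<And>A B. A \<in> P \<Longrightarrow> B \<in> P \<Longrightarrow> A \<noteq> B \<Longrightarrow> \<exists>d. \<forall>x\<in>A. \<forall>y\<in>B. g x y = d"
        unfolding W.blocks_def by blast+
      have sub: "A \<subseteq> W" and ne: "A \<noteq> {}" if "A \<in> P" for A
        using partition_on_block[OF part that] .
      have other: "\<exists>B\<in>P. B \<noteq> A" for A
      proof (rule ccontr)
        assume "\<not> ?thesis"
        then have "P \<subseteq> {A}" by blast
        then have "card P \<le> card {A}" by (intro card_mono) auto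
        then show False using P2 by simp
      qed
      \<comment> \<open>In \<open>cut\<close> the block \<open>A\<close> remains closed under
        \<open>c\<close>; in \<open>all\<close> the vertex \<open>v\<close> is isolated in every
        other colour; in \<open>mix\<close> a third colour turns out not to leave the block of
        \<open>y\<close>.\<close>
      consider (cut) A where "A \<in> P" "\<forall>x\<in>A. g v x \<noteq> c"
        | (all) "\<forall>x\<in>W. g v x = c"
        | (mix) y where "\<forall>A\<in>P. \<exists>x\<in>A. g v x = c" "y \<in> W" "g v y \<noteq> c" by blast
      then show ?thesis
      proof cases
        case cut
        then show ?thesis using c sub[OF cut(1)] ne[OF cut(1)] nocol[OF cut(1)] insert.hyps(2) V.sym
          by (intro bexI[of _ c] exI[of _ A]) auto
      next
        case all
        obtain e where "e \<in> {1, 2, 3}" "e \<noteq> c" using third_colour by blast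
        moreover have "W \<noteq> {}" using True by auto
        ultimately show ?thesis using all insert.hyps(2)
          by (intro bexI[of _ e] exI[of _ "{v}"]) auto
      next
        case mix
        obtain A where A: "A \<in> P" "y \<in> A" using partition_on_ex_block[OF part mix(2)] by blast
        \<comment> \<open>The block of \<open>w\<close> contains \<open>x\<close> with
          \<open>vx\<close> of colour \<open>c\<close>. In the triangle \<open>v, u', x\<close> the
          other two edges avoid \<open>c\<close>, so they agree; homogeneity between blocks
          transfers this to \<open>uw\<close>.\<close>
        have key: "g u w = g v u'"
          if u: "u \<in> A" "u' \<in> A" "g v u' \<noteq> c" "w \<in> W - A" for u u' w
        proof -
          obtain B where B: "B \<in> P" "w \<in> B" using partition_on_ex_block[OF part, of w] u(4) by blast
          then have "A \<noteq> B" using that by auto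
          then obtain d where d: "\<forall>x\<in>A. \<forall>y\<in>B. g x y = d" using hom A B by blast
          obtain x where x: "x \<in> B" "g v x = c" using mix(1) B by blast
          have "x \<notin> A"
            using partition_on_disjoint_blocks[OF part A(1) B(1) \<open>A \<noteq> B\<close>] x by blast
          have "g u' x \<noteq> c" using nocol[OF A(1) that(2)] x sub[OF B(1)] \<open>x \<notin> A\<close> by auto
          moreover have "distinct [v, u', x]"
            using that \<open>x \<notin> A\<close> x sub[OF B(1)] sub[OF A(1)] insert.hyps(2) by auto
          moreover have "v \<in> insert v W" "u' \<in> insert v W" "x \<in> insert v W"
            using u(2) x(1) sub[OF B(1)] sub[OF A(1)] by blast+
          ultimately have "g u' x = g v u'"
            using V.no_rainbow[of v u' x] u(3) x(2) by metis
          then show ?thesis using d that x B by metis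
        qed
        \<comment> \<open>By \<open>key\<close>, edges from \<open>A\<close> to the rest of
          \<open>W\<close> have the colour of \<open>vy\<close>, and edges from \<open>A\<close> to
          \<open>v\<close> have that colour or \<open>c\<close>; so \<open>e\<close> never leaves
          \<open>A\<close>.\<close>
        obtain e where e: "e \<in> {1, 2, 3}" "e \<noteq> c" "e \<noteq> g v y" using third_colour by blast
        obtain B where B: "B \<in> P" "B \<noteq> A" using other by blast
        then obtain w where w: "w \<in> W - A"
          using partition_on_disjoint_blocks[OF part B(1) A(1) B(2)] ne[OF B(1)] sub[OF B(1)] by blast
        have "g x z \<noteq> e" if "x \<in> A" "z \<in> insert v W - A" for x z
        proof (cases "z = v")
          case True
          then show ?thesis using key[of y y w] key[of y x w] mix A e w that V.sym by metis
        next
          case False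
          then show ?thesis using key[of x y z] that A mix e by auto
        qed
        then show ?thesis using e(1) sub[OF A(1)] ne[OF A(1)] insert.hyps(2)
          by (intro bexI[of _ e] exI[of _ A]) auto
      qed
    qed
  qed
qed

lemma (in gallai3) blocks_colour:
  assumes "blocks c P" "A \<in> P" "B \<in> P" "A \<noteq> B"
  shows "\<exists>d\<in>{1, 2, 3}. d \<noteq> c \<and> (\<forall>x\<in>A. \<forall>y\<in>B. g x y = d \<and> g y x = d)"
proof -
  from assms(1) have part: "partition_on V P"
    and nocol: "\<forall>A\<in>P. \<forall>x\<in>A. \<forall>y\<in>V - A. g x y \<noteq> c"
    and hom: "\<forall>A\<in>P. \<forall>B\<in>P. A \<noteq> B \<longrightarrow> (\<exists>d. \<forall>x\<in>A. \<forall>y\<in>B. g x y = d)"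
    by (simp_all add: blocks_def)
  obtain d where d: "\<forall>x\<in>A. \<forall>y\<in>B. g x y = d" using hom assms(2-4) by blast
  note sub = partition_on_block(1)[OF part assms(2)] partition_on_block(1)[OF part assms(3)]
  have disj: "A \<inter> B = {}" and "A \<noteq> {}" "B \<noteq> {}"
    using partition_on_block(2)[OF part] partition_on_disjoint_blocks[OF part] assms(2-4) by blast+
  then obtain x y where xy: "x \<in> A" "y \<in> B" by blast
  then have "y \<in> V - A" "x \<noteq> y" using sub disj by auto
  then have "g x y \<noteq> c" "g x y \<in> {1, 2, 3}"
    using nocol assms(2) col[of x y] xy sub by blast+
  moreover have "g x y = d" using d xy by blast
  moreover have "\<forall>x\<in>A. \<forall>y\<in>B. g x y = d \<and> g y x = d" using d sym by metis
  ultimately show ?thesis by blast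
qed

text \<open>Two blocks are already a split. Among three blocks the three joins use two colours, so
  two joins agree and their common block splits off.\<close>

lemma gallai3_split:
  assumes "gallai3 V g" "card V \<ge> 2"
  shows "(\<exists>d S. S \<noteq> {} \<and> S \<subset> V \<and> (\<forall>x\<in>S. \<forall>y\<in>V - S. g x y = d)) \<or>
    (\<exists>c\<in>{1, 2, 3}. \<exists>P. gallai3.blocks V g c P \<and> card P \<ge> 4)"
proof -
  interpret gallai3 V g by fact
  obtain c P where c: "c \<in> {1, 2, 3}" and P: "blocks c P"
    using gallai3_ex_cut[OF assms] ex_blocks by metis
  have part: "partition_on V P" using P by (simp add: blocks_def)
  consider "card P = 2" | "card P = 3" | "card P \<ge> 4" using P unfolding blocks_def by linarith
  then show ?thesis
  proof cases
    case 1
    then obtain A B where AB: "P = {A, B}" "A \<noteq> B" by (auto simp: card_2_iff)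
    obtain d where d: "\<forall>x\<in>A. \<forall>y\<in>B. g x y = d \<and> g y x = d"
      using blocks_colour[OF P, of A B] AB by blast
    have "V = A \<union> B" "A \<inter> B = {}" "A \<noteq> {}" "B \<noteq> {}"
      using part AB by (auto simp: partition_on_def disjoint_def)
    then show ?thesis using d by (intro disjI1 exI[of _ d] exI[of _ A]) auto
  next
    case 2
    then obtain A B C where ABC: "P = {A, B, C}" "A \<noteq> B" "A \<noteq> C" "B \<noteq> C" by (auto simp: card_3_iff)
    have V: "V = A \<union> B \<union> C" "A \<inter> B = {}" "A \<inter> C = {}" "B \<inter> C = {}" "A \<noteq> {}" "B \<noteq> {}" "C \<noteq> {}"
      using part ABC by (auto simp: partition_on_def disjoint_def)
    obtain d where d: "d \<in> {1, 2, 3}" "d \<noteq> c" "\<forall>x\<in>A. \<forall>y\<in>B. g x y = d \<and> g y x = d"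
      using blocks_colour[OF P, of A B] ABC by blast
    obtain e where e: "e \<in> {1, 2, 3}" "e \<noteq> c" "\<forall>x\<in>A. \<forall>y\<in>C. g x y = e \<and> g y x = e"
      using blocks_colour[OF P, of A C] ABC by blast
    obtain h where h: "h \<in> {1, 2, 3}" "h \<noteq> c" "\<forall>x\<in>B. \<forall>y\<in>C. g x y = h \<and> g y x = h"
      using blocks_colour[OF P, of B C] ABC by blast
    consider "d = e" | "d = h" | "e = h" using c d(1,2) e(1,2) h(1,2) by auto
    then show ?thesis
    proof cases
      case 1
      then show ?thesis using d(3) e(3) V by (intro disjI1 exI[of _ d] exI[of _ A]) auto
    next
      case 2
      then show ?thesis using d(3) h(3) V by (intro disjI1 exI[of _ d] exI[of _ B]) auto
    next
      case 3
      then show ?thesis using e(3) h(3) V by (intro disjI1 exI[of _ e] exI[of _ C]) auto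
    qed
  next
    case 3
    then show ?thesis using c P by blast
  qed
qed

section \<open>Upper bound\<close>

text \<open>The clause \<open>y \<noteq> x\<close> excludes the diagonal, where \<open>g\<close> is
  arbitrary.\<close>

definition nbhd :: "'a set \<Rightarrow> ('a \<Rightarrow> 'a \<Rightarrow> nat) \<Rightarrow> nat \<Rightarrow> 'a \<Rightarrow> 'a set" where
  "nbhd V g c x = {y \<in> V. y \<noteq> x \<and> g x y = c}"

lemma finite_nbhd: "finite V \<Longrightarrow> finite (nbhd V g c x)"
  by (simp add: nbhd_def)

context gallai3
begin

lemma nbhd_block:
  assumes "blocks c P" "A \<in> P" "x \<in> A"
  shows "nbhd V g c x \<subseteq> A - {x}" "card (nbhd V g c x) < card A"
proof -
  show sub: "nbhd V g c x \<subseteq> A - {x}" using assms by (auto simp: nbhd_def blocks_def)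
  have "finite A"
    using assms(1,2) fin partition_on_block(1) finite_subset unfolding blocks_def by metis
  then have "A - {x} \<subset> A" "finite A" using assms(3) by auto
  then show "card (nbhd V g c x) < card A"
    using sub by (meson le_less_trans psubset_card_mono card_mono finite_Diff)
qed

text \<open>With \<open>D\<close> smallest, lower bounds on sums of two block sizes later determine
  all four sizes; the conditional equation then rules out further blocks.\<close>

lemma ex_four_blocks:
  assumes P: "blocks c P" and "card P \<ge> 4"
  obtains A B C D where "{A, B, C, D} \<subseteq> P" "distinct [A, B, C, D]"
    "card D \<le> card A" "card D \<le> card B" "card D \<le> card C"
    "card A + card B + card C + card D \<le> card V"
    "card A + card B + card C + card D = card V \<Longrightarrow> V = A \<union> B \<union> C \<union> D"
proof -
  have part: "partition_on V P" using P by (simp add: blocks_def)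
  obtain Q where Q: "Q \<subseteq> P" "card Q = 4" using obtain_subset_with_card_n[OF assms(2)] by metis
  have finQ: "finite Q" "Q \<noteq> {}" using Q(2) by (auto intro: card_ge_0_finite)
  have D: "arg_min_on card Q \<in> Q" "\<And>X. X \<in> Q \<Longrightarrow> card (arg_min_on card Q) \<le> card X"
    using arg_min_if_finite(1)[OF finQ, of card] arg_min_least[OF finQ, of _ card] by auto
  define D where "D = arg_min_on card Q"
  note D = D[folded D_def]
  have "card (Q - {D}) = 3" using Q D finQ by simp
  then obtain A B C where ABC: "Q - {D} = {A, B, C}" "A \<noteq> B" "A \<noteq> C" "B \<noteq> C"
    by (auto simp: card_3_iff)
  then have Q4: "Q = {A, B, C, D}" and dist: "distinct [A, B, C, D]" using D(1) by auto
  have "card (\<Union>Q) = sum card Q"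
  proof (rule card_Union_disjoint)
    show "pairwise disjnt Q"
      using partition_on_disjoint_blocks[OF part] Q(1) by (auto simp: pairwise_def disjnt_def)
    show "finite X" if "X \<in> Q" for X
      using partition_on_block(1)[OF part, of X] that Q(1) fin by (auto intro: finite_subset)
  qed
  then have sum: "card (\<Union>Q) = card A + card B + card C + card D" using Q4 dist by simp
  have sub: "\<Union>Q \<subseteq> V" using partition_on_block(1)[OF part] Q(1) by blast
  show thesis
  proof (rule that[of A B C D])
    show "card A + card B + card C + card D \<le> card V"
      using card_mono[OF fin sub] sum by simp
    assume "card A + card B + card C + card D = card V"
    then have "\<Union>Q = V" using card_subset_eq[OF fin sub] sum by simp
    then show "V = A \<union> B \<union> C \<union> D" using Q4 by auto
  qed (use Q Q4 dist D in auto)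
qed

text \<open>Three joins leave \<open>A\<close> in two available colours, so two joins agree, and the
  other colour can reach only the third block.\<close>

lemma colour_in_one_block:
  assumes P: "blocks c P" "{A, B, C, D} \<subseteq> P" "distinct [A, B, C, D]" and V: "V = A \<union> B \<union> C \<union> D"
    and c: "c \<in> {1, 2, 3}"
  shows "\<exists>e\<in>{1, 2, 3}. e \<noteq> c \<and> (\<exists>X\<in>{B, C, D}. \<forall>x\<in>A. \<forall>y\<in>V - A. g x y = e \<longrightarrow> y \<in> X)"
proof -
  have AP: "A \<in> P" "B \<in> P" "C \<in> P" "D \<in> P" using P(2) by auto
  have ne: "A \<noteq> B" "A \<noteq> C" "A \<noteq> D" using P(3) by auto
  obtain p where p: "p \<in> {1, 2, 3}" "p \<noteq> c" "\<forall>x\<in>A. \<forall>y\<in>B. g x y = p"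
    using blocks_colour[OF P(1) AP(1) AP(2) ne(1)] by blast
  obtain q where q: "q \<in> {1, 2, 3}" "q \<noteq> c" "\<forall>x\<in>A. \<forall>y\<in>C. g x y = q"
    using blocks_colour[OF P(1) AP(1) AP(3) ne(2)] by blast
  obtain s where s: "s \<in> {1, 2, 3}" "s \<noteq> c" "\<forall>x\<in>A. \<forall>y\<in>D. g x y = s"
    using blocks_colour[OF P(1) AP(1) AP(4) ne(3)] by blast
  consider "p = q" | "p \<noteq> q" "s = p" | "p \<noteq> q" "s = q" using c p q s by auto
  then show ?thesis
  proof cases
    case 1
    \<comment> \<open>If \<open>s = p\<close> as well, then \<open>e\<close> does not leave
      \<open>A\<close> and \<open>D\<close> serves vacuously.\<close>
    obtain e where "e \<in> {1, 2, 3}" "e \<noteq> c" "e \<noteq> p" using third_colour by blast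
    then show ?thesis using 1 p(3) q(3) V by (intro bexI[of _ e] conjI bexI[of _ D]) auto
  next
    case 2
    then show ?thesis using p(3) q s(3) V by (intro bexI[of _ q] conjI bexI[of _ C]) auto
  next
    case 3
    then show ?thesis using p q(3) s(3) V by (intro bexI[of _ p] conjI bexI[of _ B]) auto
  qed
qed

end

section \<open>Excluded configurations on 6 and 11 vertices\<close>

text \<open>For an edge \<open>xy\<close> not of colour \<open>c\<close>, colour \<open>c\<close> occurs at \<open>x\<close> or \<open>y\<close> towards every other
  vertex; hence colour \<open>d\<close> does not occur at all and the remaining two colours form no
  monochromatic triangle, contradicting R(3,3) = 6.\<close>
lemma no_gallai3_6:
  assumes "gallai3 S g" "card S = 6" and d: "d \<in> {1, 2, 3}"
    and large: "\<And>c x y. c \<in> {1, 2, 3} \<Longrightarrow> c \<noteq> d \<Longrightarrow> x \<in> S \<Longrightarrow> y \<in> S \<Longrightarrow> x \<noteq> y \<Longrightarrow> g x y \<noteq> c \<Longrightarrow>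
      card (nbhd S g c x \<union> nbhd S g c y) \<ge> 4"
  shows False
proof -
  interpret gallai3 S g by fact
  \<comment> \<open>Both neighbourhoods lie in the four-element set \<open>S - {x, y}\<close>, so a
    union of size four fills it.\<close>
  have dom: "g x z = c \<or> g y z = c"
    if "c \<in> {1, 2, 3}" "c \<noteq> d" "x \<in> S" "y \<in> S" "x \<noteq> y" "g x y \<noteq> c" "z \<in> S" "z \<noteq> x" "z \<noteq> y" for c x y z
  proof -
    have sub: "nbhd S g c x \<union> nbhd S g c y \<subseteq> S - {x, y}"
      using that sym[of x y] by (auto simp: nbhd_def)
    have "card (S - {x, y}) = 4" using that assms(2) fin by (simp add: card_Diff_subset)
    then have "nbhd S g c x \<union> nbhd S g c y = S - {x, y}"
      using large[OF that(1-6)] fin sub by (intro card_seteq) auto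
    then show ?thesis using that by (auto simp: nbhd_def)
  qed
  obtain b where b: "b \<in> {1, 2, 3}" "b \<noteq> d" using third_colour by blast
  obtain c where c: "c \<in> {1, 2, 3}" "c \<noteq> d" "c \<noteq> b" using third_colour by blast
  have nod: "g x y \<noteq> d" if "x \<in> S" "y \<in> S" "x \<noteq> y" for x y
  proof
    assume gd: "g x y = d"
    have "card (S - {x, y}) = 4" using that assms(2) fin by (simp add: card_Diff_subset)
    then obtain z where z: "z \<in> S" "z \<noteq> x" "z \<noteq> y"
      by (metis DiffE card.empty equals0I insertCI zero_neq_numeral)
    \<comment> \<open>With \<open>d\<close> on \<open>xy\<close>, both \<open>b\<close> and
      \<open>c\<close> must occur at \<open>z\<close>: a rainbow triangle.\<close>
    then have "g x z = b \<or> g y z = b" "g x z = c \<or> g y z = c"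
      using dom[OF b that _ z] dom[OF c(1,2) that _ z] gd b c by auto
    then show False using no_rainbow[of x y z] z that gd b c by auto
  qed
  have two: "g x y = b \<or> g x y = c" if "x \<in> S" "y \<in> S" "x \<noteq> y" for x y
    using col[OF that] nod[OF that] b c d by auto
  \<comment> \<open>Since \<open>xy\<close> avoids the colour \<open>h\<close> other than
    \<open>e\<close>, \<open>dom\<close> puts \<open>h\<close> on \<open>xz\<close> or
    \<open>yz\<close>.\<close>
  have tri: False if e: "e \<in> {b, c}" and that: "{x, y, z} \<subseteq> S" "distinct [x, y, z]" "g x y = e" "g x z = e" "g y z = e"
    for e x y z
  proof -
    obtain h where h: "h \<in> {b, c}" "h \<noteq> e" using e c by blast
    then show False using dom[of h x y z] that b c by auto
  qed
  \<comment> \<open>The classical R(3,3) argument: three of the five edges at \<open>v\<close> share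
    a colour \<open>e\<close>, and their far ends span an edge of colour \<open>e\<close> or a
    triangle of colour \<open>h\<close>.\<close>
  obtain v where v: "v \<in> S" using assms(2) by fastforce
  have "S - {v} = nbhd S g b v \<union> nbhd S g c v" using v two by (auto simp: nbhd_def)
  moreover have "card (S - {v}) = 5" using v assms(2) fin by simp
  ultimately have "card (nbhd S g b v) + card (nbhd S g c v) \<ge> 5"
    using card_Un_le[of "nbhd S g b v" "nbhd S g c v"] by simp
  then consider "card (nbhd S g b v) \<ge> 3" | "card (nbhd S g c v) \<ge> 3" by linarith
  then obtain e T where e: "e \<in> {b, c}" and T: "T \<subseteq> nbhd S g e v" "card T = 3"
    by (metis obtain_subset_with_card_n insertCI)
  obtain x y z where xyz: "T = {x, y, z}" "x \<noteq> y" "x \<noteq> z" "y \<noteq> z"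
    using T(2) by (auto simp: card_3_iff)
  have S: "x \<in> S" "y \<in> S" "z \<in> S" and ne: "x \<noteq> v" "y \<noteq> v" "z \<noteq> v"
    and ge: "g v x = e" "g v y = e" "g v z = e"
    using T(1) xyz(1) by (auto simp: nbhd_def)
  have xy: "g x y \<noteq> e" and xz: "g x z \<noteq> e" and yz: "g y z \<noteq> e"
    using tri[OF e, of v x y] tri[OF e, of v x z] tri[OF e, of v y z] v S ne ge xyz by auto
  obtain h where h: "h \<in> {b, c}" "h \<noteq> e" using e c by blast
  have "g x y = h" "g x z = h" "g y z = h"
    using two[of x y] two[of x z] two[of y z] xy xz yz S xyz e h by auto
  then show False using tri[OF h(1), of x y z] S xyz by auto
qed

text \<open>Models eleven vertices all joined in colour \<open>r\<close> to one further vertex. That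
  vertex sees only \<open>r\<close>, which gives \<open>large\<close>; deleting it lowers the bound
  in \<open>pair\<close> from four to three.\<close>

lemma no_gallai3_11:
  assumes "gallai3 B g" "card B = 11" and r: "r \<in> {1, 2, 3}"
    and small: "\<And>x. x \<in> B \<Longrightarrow> card (nbhd B g r x) \<le> 2"
    and large: "\<And>c x. c \<in> {1, 2, 3} \<Longrightarrow> c \<noteq> r \<Longrightarrow> x \<in> B \<Longrightarrow> card (nbhd B g c x) \<ge> 4"
    and pair: "\<And>x y. x \<in> B \<Longrightarrow> y \<in> B \<Longrightarrow> x \<noteq> y \<Longrightarrow> g x y \<noteq> r \<Longrightarrow>
      card (nbhd B g r x \<union> nbhd B g r y) \<ge> 3"
  shows False
proof -
  interpret gallai3 B g by fact
  have pair': "card (nbhd B g r x) + card (nbhd B g r y) \<ge> 3"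
    if "x \<in> B" "y \<in> B" "x \<noteq> y" "g x y \<noteq> r" for x y
    using pair[OF that] card_Un_le[of "nbhd B g r x" "nbhd B g r y"] by linarith
  have two: "card B \<ge> 2" using assms(2) by simp
  consider (bip) c C where "C \<noteq> {}" "C \<subset> B" "\<forall>x\<in>C. \<forall>y\<in>B - C. g x y = c"
    | (multi) c P where "c \<in> {1, 2, 3}" "blocks c P" "card P \<ge> 4"
    using gallai3_split[OF assms(1) two] by blast
  then show False
  proof cases
    case bip
    define D where "D = B - C"
    have finC: "finite C" "finite D" using bip(2) fin unfolding D_def by (auto intro: finite_subset)
    have BCD: "B = C \<union> D" "C \<inter> D = {}" "D \<noteq> {}" using bip(2) by (auto simp: D_def)
    then have card11: "card C + card D = 11" using assms(2) finC by (simp add: card_Un_disjoint)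
    have cD: "g x y = c" "g y x = c" if "x \<in> C" "y \<in> D" for x y
      using bip(3) that sym by (auto simp: D_def)
    obtain x0 y0 where xy0: "x0 \<in> C" "y0 \<in> D" using bip(1) BCD(3) by blast
    show False
    proof (cases "c = r")
      case True
      \<comment> \<open>By \<open>small\<close> each side would have at most two vertices.\<close>
      have "D \<subseteq> nbhd B g r x0" "C \<subseteq> nbhd B g r y0"
        using xy0 BCD cD True by (auto simp: nbhd_def)
      then have "card D \<le> card (nbhd B g r x0)" "card C \<le> card (nbhd B g r y0)"
        by (auto intro!: card_mono finite_nbhd fin)
      then show False using small[of x0] small[of y0] card11 xy0 BCD by auto
    next
      case False
      \<comment> \<open>Colour \<open>e\<close> stays inside the sides, so degree four forces five
        vertices on each and the sizes are 5 and 6. A vertex of the side of size 5 then has no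
        \<open>r\<close>-neighbour, so one across would need three.\<close>
      obtain e where e: "e \<in> {1, 2, 3}" "e \<noteq> r" "e \<noteq> c" using third_colour by blast
      have main: False
        if X: "X \<union> Y = B" "X \<inter> Y = {}" "y \<in> Y" "x \<in> X" "card X = 5"
          and XY: "\<And>x y. x \<in> X \<Longrightarrow> y \<in> Y \<Longrightarrow> g x y = c" for X Y x y
      proof -
        have sub: "nbhd B g e x \<subseteq> X - {x}" using X XY e by (auto simp: nbhd_def)
        have "finite X" using X(5) by (auto intro: card_ge_0_finite)
        moreover have "card (X - {x}) = 4" using X by simp
        moreover have "x \<in> B" using X by blast
        then have "card (nbhd B g e x) \<ge> 4" by (rule large[OF e(1,2)])
        ultimately have "nbhd B g e x = X - {x}" using sub by (intro card_seteq) auto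
        then have "g x u = e" if "u \<in> X" "u \<noteq> x" for u using that by (auto simp: nbhd_def)
        moreover have "g x u = c" if "u \<in> Y" for u using XY X(4) that by blast
        moreover have "u \<in> X \<or> u \<in> Y" if "u \<in> B" for u using X(1) that by blast
        ultimately have "g x u \<noteq> r" if "u \<in> B" "u \<noteq> x" for u using that e(2) False by metis
        then have "nbhd B g r x = {}" by (auto simp: nbhd_def)
        moreover have "g x y \<noteq> r" "x \<noteq> y" "x \<in> B" "y \<in> B" using X(1-4) XY[of x y] False by blast+
        ultimately show False using pair'[of x y] small[of y] by simp
      qed
      have five: "card X \<ge> 5"
        if X: "X \<union> Y = B" "x \<in> X" "finite X" and XY: "\<And>x y. x \<in> X \<Longrightarrow> y \<in> Y \<Longrightarrow> g x y = c" for X Y x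
      proof -
        have "nbhd B g e x \<subseteq> X - {x}" using X XY e by (auto simp: nbhd_def)
        then have "card (nbhd B g e x) \<le> card (X - {x})" using X by (intro card_mono) auto
        then show ?thesis using large[OF e(1,2), of x] X card_Suc_Diff1[of X x] by auto
      qed
      have "card C \<ge> 5" "card D \<ge> 5"
        using five[of C D x0] five[of D C y0] xy0 finC BCD cD by auto
      then consider "card C = 5" | "card D = 5" using card11 by linarith
      then show False
        using main[of C D y0 x0] main[of D C x0 y0] xy0 BCD cD by cases auto
    qed
  next
    case multi
    obtain A1 A2 A3 D where Q: "{A1, A2, A3, D} \<subseteq> P" "distinct [A1, A2, A3, D]"
      and min: "card D \<le> card A1" "card D \<le> card A2" "card D \<le> card A3"
      and le: "card A1 + card A2 + card A3 + card D \<le> card B"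
      and eq: "card A1 + card A2 + card A3 + card D = card B \<Longrightarrow> B = A1 \<union> A2 \<union> A3 \<union> D"
      using ex_four_blocks[OF multi(2,3)] by metis
    have part: "partition_on B P" using multi(2) by (simp add: blocks_def)
    note block = partition_on_block[OF part]
    obtain y where y: "y \<in> D" "y \<in> B" using block[of D] Q by blast
    have degy: "card (nbhd B g c y) < card D" using nbhd_block[OF multi(2) _ y(1)] Q by auto
    show False
    proof (cases "c = r")
      case False
      \<comment> \<open>All four blocks would have at least five vertices.\<close>
      then have "card D \<ge> 5" using large[OF multi(1) False y(2)] degy by simp
      then show False using min le assms(2) by simp
    next
      case True
      have deg: "card (nbhd B g r u) + card (nbhd B g r w) \<ge> 3"
        if XY: "X \<in> P" "Y \<in> P" "X \<noteq> Y" "u \<in> X" "w \<in> Y" for X Y u w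
      proof -
        obtain d where "d \<noteq> c" "g u w = d" using blocks_colour[OF multi(2) XY(1-3)] XY(4,5) by blast
        moreover have "u \<noteq> w" using partition_on_disjoint_blocks[OF part XY(1-3)] XY(4,5) by blast
        ultimately show ?thesis using pair'[of u w] block XY True by blast
      qed
      have five: "card X + card Y \<ge> 5" if XY: "X \<in> P" "Y \<in> P" "X \<noteq> Y" for X Y
      proof -
        obtain u w where uw: "u \<in> X" "w \<in> Y" using XY block by blast
        show ?thesis
          using deg[OF XY uw, folded True] nbhd_block(2)[OF multi(2) XY(1) uw(1)]
            nbhd_block(2)[OF multi(2) XY(2) uw(2)] by linarith
      qed
      have "card A1 + card A2 \<ge> 5" "card A1 + card D \<ge> 5" "card A2 + card D \<ge> 5" "card A3 + card D \<ge> 5"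
        using five Q by auto
      \<comment> \<open>If \<open>card D \<le> 1\<close>, the other blocks have at least four
        vertices each; if \<open>card D \<ge> 3\<close>, all have at least three. Both totals exceed
        11.\<close>
      then have sizes: "card D = 2" "card A1 = 3" "card A2 = 3" "card A3 = 3"
        using min le assms(2) by linarith+
      then have B: "B = A1 \<union> A2 \<union> A3 \<union> D" using eq assms(2) by simp
      obtain x where x: "x \<in> A1" "x \<in> B" using block[of A1] Q by blast
      \<comment> \<open>\<open>y\<close> has \<open>r\<close>-degree at most one, so
        \<open>x\<close> has at least two, which fills \<open>A1 - {x}\<close>. A colour reaching
        only one block then has degree at most three at \<open>x\<close>.\<close>
      have "card (nbhd B g r x) \<ge> 2" using deg[of A1 D x y] x y Q degy sizes(1) True by auto
      moreover have "finite A1" using sizes by (auto intro: card_ge_0_finite)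
      ultimately have "nbhd B g c x = A1 - {x}"
        using nbhd_block(1)[OF multi(2), of A1 x] Q x sizes True by (intro card_seteq) auto
      then have inA: "g x u = c" if "u \<in> A1 - {x}" for u using that by (auto simp: nbhd_def)
      obtain e X where e: "e \<in> {1, 2, 3}" "e \<noteq> c" and X: "X \<in> {A2, A3, D}"
        and eX: "\<forall>x\<in>A1. \<forall>y\<in>B - A1. g x y = e \<longrightarrow> y \<in> X"
        using colour_in_one_block[OF multi(2) Q B multi(1)] by blast
      have "finite X" "card X \<le> 3" using X sizes by (auto intro: card_ge_0_finite)
      moreover have "nbhd B g e x \<subseteq> X" using x inA eX e by (auto simp: nbhd_def)
      ultimately have "card (nbhd B g e x) \<le> 3" using card_mono le_trans by metis
      then show False using large[of e x] e x True by simp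
    qed
  qed
qed

text \<open>Of the ten vertices other than \<open>x\<close> and \<open>y\<close>, excluding at most
  three leaves the seven pages.\<close>

lemma gallai3_12:
  assumes "gallai3 V g" "card V = 12"
  shows "\<exists>c\<in>{1, 2, 3}. \<exists>x\<in>V. \<exists>y\<in>V. x \<noteq> y \<and> g x y \<noteq> c \<and> card (nbhd V g c x \<union> nbhd V g c y) \<le> 3"
proof (rule ccontr)
  assume neg: "\<not> ?thesis"
  have large: "card (nbhd V g c x \<union> nbhd V g c y) \<ge> 4"
    if "c \<in> {1, 2, 3}" "x \<in> V" "y \<in> V" "x \<noteq> y" "g x y \<noteq> c" for c x y
  proof (rule ccontr)
    assume "\<not> ?thesis"
    then have "card (nbhd V g c x \<union> nbhd V g c y) \<le> 3" by simp
    then show False using neg that by blast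
  qed
  interpret gallai3 V g by fact
  have two: "card V \<ge> 2" using assms(2) by simp
  consider (bip) d S where "S \<noteq> {}" "S \<subset> V" "\<forall>x\<in>S. \<forall>y\<in>V - S. g x y = d"
    | (multi) c P where "c \<in> {1, 2, 3}" "blocks c P" "card P \<ge> 4"
    using gallai3_split[OF assms(1) two] by blast
  then show False
  proof cases
    case bip
    define T where "T = V - S"
    have finST: "finite S" "finite T" using bip(2) fin unfolding T_def by (auto intro: finite_subset)
    have VST: "V = S \<union> T" "S \<inter> T = {}" "T \<noteq> {}" using bip(2) by (auto simp: T_def)
    then have card12: "card S + card T = 12" using assms(2) finST by (simp add: card_Un_disjoint)
    have dST: "g x y = d" "g y x = d" if "x \<in> S" "y \<in> T" for x y
      using bip(3) that sym by (auto simp: T_def)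
    obtain x0 y0 where xy0: "x0 \<in> S" "y0 \<in> T" using bip(1) VST(3) by blast
    then have din: "d \<in> {1, 2, 3}" using dST[of x0 y0] col[of x0 y0] VST by blast
    \<comment> \<open>Colours other than \<open>d\<close> do not cross the split.\<close>
    have nS: "nbhd V g c x = nbhd S g c x" if "x \<in> S" "c \<noteq> d" for c x
      using that VST dST by (auto simp: nbhd_def)
    have nT: "nbhd V g c x = nbhd T g c x" if "x \<in> T" "c \<noteq> d" for c x
      using that VST dST by (auto simp: nbhd_def)
    have six: "card X \<ge> 6"
      if X: "X \<subseteq> V" "finite X" "card X \<noteq> 1" "X \<noteq> {}"
        and X5: "\<And>c x. x \<in> X \<Longrightarrow> c \<noteq> d \<Longrightarrow> nbhd V g c x = nbhd X g c x" for X
    proof -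
      obtain x where x: "x \<in> X" using X by blast
      then have "card (X - {x}) \<noteq> 0" using X by (metis card_Suc_Diff1 One_nat_def)
      then obtain y where y: "y \<in> X" "y \<noteq> x" by (metis Diff_iff card.empty equals0I singletonI)
      \<comment> \<open>The \<open>c\<close>-neighbourhoods of \<open>x\<close> and \<open>y\<close>
        avoid both vertices and stay in \<open>X\<close>, so \<open>X\<close> has at least 4 + 2
        vertices.\<close>
      obtain c where c: "c \<in> {1, 2, 3}" "c \<noteq> d" "c \<noteq> g x y" using third_colour by blast
      have "nbhd V g c x \<union> nbhd V g c y \<subseteq> X - {x, y}"
        using X5[OF x c(2)] X5[OF y(1) c(2)] c(3) sym[of x y] by (auto simp: nbhd_def)
      then have "card (nbhd V g c x \<union> nbhd V g c y) \<le> card (X - {x, y})"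
        using X(2) by (intro card_mono) auto
      moreover have "card (X - {x, y}) = card X - 2"
        using x y by (simp add: card_Diff_subset)
      moreover have "card (nbhd V g c x \<union> nbhd V g c y) \<ge> 4" using large[of c x y] c x y X(1) by blast
      ultimately show ?thesis by linarith
    qed
    have eleven: False
      if XV: "insert v X = V" "v \<notin> X" and vX: "\<And>x. x \<in> X \<Longrightarrow> g v x = d" for v X
    proof -
      have finX: "finite X" using XV(1) fin by (metis finite_insert)
      have cX: "card X = 11" using assms(2) XV finX by auto
      have xv: "g x v = d" if "x \<in> X" for x using vX[OF that] sym by metis
      have nv: "nbhd V g c v = {}" if "c \<noteq> d" for c using that XV vX by (auto simp: nbhd_def)
      have nX: "nbhd V g c x = nbhd X g c x" if "c \<noteq> d" "x \<in> X" for c x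
        using that XV xv by (auto simp: nbhd_def)
      have nd: "nbhd V g d x = insert v (nbhd X g d x)" if "x \<in> X" for x
        using that XV xv by (auto simp: nbhd_def)
      \<comment> \<open>In the edge \<open>vx\<close>, of colour \<open>d\<close>, the end
        \<open>v\<close> has no \<open>c\<close>-neighbour, so \<open>x\<close> supplies all
        four.\<close>
      have lg: "card (nbhd X g c x) \<ge> 4" if "c \<in> {1, 2, 3}" "c \<noteq> d" "x \<in> X" for c x
        using large[of c v x] that nv nX vX XV by auto
      show False
      proof (rule no_gallai3_11[OF gallai3_subset cX din])
        show "X \<subseteq> V" using XV by auto
        show "card (nbhd X g d x) \<le> 2" if x: "x \<in> X" for x
        proof -
          \<comment> \<open>The colours \<open>b\<close> and \<open>c\<close> take at least eight of
            the ten edges at \<open>x\<close> inside \<open>X\<close>.\<close>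
          obtain b where b: "b \<in> {1, 2, 3}" "b \<noteq> d" using third_colour by blast
          obtain c where c: "c \<in> {1, 2, 3}" "c \<noteq> d" "c \<noteq> b" using third_colour by blast
          have fn: "finite (nbhd X g k x)" for k by (rule finite_nbhd[OF finX])
          have "nbhd X g d x \<inter> (nbhd X g b x \<union> nbhd X g c x) = {}" "nbhd X g b x \<inter> nbhd X g c x = {}"
            using b(2) c(2,3) by (auto simp: nbhd_def)
          then have "card (nbhd X g d x \<union> (nbhd X g b x \<union> nbhd X g c x)) =
              card (nbhd X g d x) + (card (nbhd X g b x) + card (nbhd X g c x))"
            using fn by (simp add: card_Un_disjoint)
          moreover have "card (nbhd X g d x \<union> (nbhd X g b x \<union> nbhd X g c x)) \<le> card (X - {x})"
            using finX by (intro card_mono) (auto simp: nbhd_def)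
          moreover have "card (X - {x}) = 10" using x cX finX by simp
          ultimately show ?thesis using lg[OF b x] lg[OF c(1,2) x] by linarith
        qed
        show "card (nbhd X g d x \<union> nbhd X g d y) \<ge> 3"
          if "x \<in> X" "y \<in> X" "x \<noteq> y" "g x y \<noteq> d" for x y
        proof -
          have "nbhd V g d x \<union> nbhd V g d y = insert v (nbhd X g d x \<union> nbhd X g d y)"
            using nd that by auto
          moreover have "v \<notin> nbhd X g d x \<union> nbhd X g d y" using XV by (auto simp: nbhd_def)
          ultimately show ?thesis using large[OF din, of x y] that XV finX
            by (auto simp: finite_nbhd)
        qed
      qed (use lg in auto)
    qed
    have "card S = 1 \<or> card S \<ge> 6" "card T = 1 \<or> card T \<ge> 6"
      using six[of S] six[of T] VST finST nS nT bip(1) by auto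
    then consider "card S = 1" | "card T = 1" | "card S = 6" using card12 by linarith
    then show False
    proof cases
      case 1
      then obtain v where "S = {v}" by (auto simp: card_1_singleton_iff)
      then show False using eleven[of v T] VST dST by auto
    next
      case 2
      then obtain v where "T = {v}" by (auto simp: card_1_singleton_iff)
      then show False using eleven[of v S] VST dST by auto
    next
      case 3
      show False
      proof (rule no_gallai3_6[OF gallai3_subset 3 din])
        show "S \<subseteq> V" using VST by auto
        show "card (nbhd S g c x \<union> nbhd S g c y) \<ge> 4"
          if "c \<in> {1, 2, 3}" "c \<noteq> d" "x \<in> S" "y \<in> S" "x \<noteq> y" "g x y \<noteq> c" for c x y
          using large[of c x y] that nS VST by auto
      qed
    qed
  next
    case multi
    obtain A1 A2 A3 D where Q: "{A1, A2, A3, D} \<subseteq> P" "distinct [A1, A2, A3, D]"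
      and min: "card D \<le> card A1" "card D \<le> card A2" "card D \<le> card A3"
      and le: "card A1 + card A2 + card A3 + card D \<le> card V"
      and eq: "card A1 + card A2 + card A3 + card D = card V \<Longrightarrow> V = A1 \<union> A2 \<union> A3 \<union> D"
      using ex_four_blocks[OF multi(2,3)] by metis
    have part: "partition_on V P" using multi(2) by (simp add: blocks_def)
    note block = partition_on_block[OF part]
    have deg: "card (nbhd V g c u) + card (nbhd V g c w) \<ge> 4"
      if XY: "X \<in> P" "Y \<in> P" "X \<noteq> Y" "u \<in> X" "w \<in> Y" for X Y u w
    proof -
      obtain d where "d \<noteq> c" "g u w = d" using blocks_colour[OF multi(2) XY(1-3)] XY(4,5) by blast
      moreover have "u \<noteq> w" using partition_on_disjoint_blocks[OF part XY(1-3)] XY(4,5) by blast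
      ultimately have "card (nbhd V g c u \<union> nbhd V g c w) \<ge> 4"
        using large[OF multi(1), of u w] block XY by blast
      then show ?thesis using card_Un_le[of "nbhd V g c u" "nbhd V g c w"] by linarith
    qed
    have six: "card X + card Y \<ge> 6" if XY: "X \<in> P" "Y \<in> P" "X \<noteq> Y" for X Y
    proof -
      obtain u w where uw: "u \<in> X" "w \<in> Y" using XY block by blast
      show ?thesis
        using deg[OF XY uw] nbhd_block(2)[OF multi(2) XY(1) uw(1)]
          nbhd_block(2)[OF multi(2) XY(2) uw(2)] by linarith
    qed
    have "card A1 + card A2 \<ge> 6" "card A1 + card D \<ge> 6" "card A2 + card D \<ge> 6" "card A3 + card D \<ge> 6"
        "card A1 + card A3 \<ge> 6" "card A2 + card A3 \<ge> 6"
      using six Q by auto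
    \<comment> \<open>\<open>card D \<le> 2\<close> would give the other blocks at least four
      vertices each and push the total above 12.\<close>
    then have sizes: "card D = 3" "card A1 = 3" "card A2 = 3" "card A3 = 3"
      using min le assms(2) by linarith+
    then have V: "V = A1 \<union> A2 \<union> A3 \<union> D" using eq assms(2) by simp
    obtain z where z: "z \<in> D" using block[of D] Q by blast
    have inA: "g x u = c" if "x \<in> A1" "u \<in> A1 - {x}" for x u
    proof -
      \<comment> \<open>Two \<open>c\<close>-degrees of at most two with sum at least four are both
        two, so \<open>A1\<close> is a triangle of colour \<open>c\<close>.\<close>
      have "card (nbhd V g c z) < card D" using nbhd_block[OF multi(2) _ z] Q by auto
      then have "card (nbhd V g c x) \<ge> 2" using deg[of A1 D x z] that z Q sizes by auto
      moreover have "finite A1" using sizes by (auto intro: card_ge_0_finite)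
      ultimately have "nbhd V g c x = A1 - {x}"
        using nbhd_block(1)[OF multi(2), of A1 x] Q that sizes by (intro card_seteq) auto
      then show ?thesis using that by (auto simp: nbhd_def)
    qed
    obtain x y where xy: "x \<in> A1" "y \<in> A1" "x \<noteq> y"
      using sizes(2) by (auto simp: card_3_iff)
    obtain e X where e: "e \<in> {1, 2, 3}" "e \<noteq> c" and X: "X \<in> {A2, A3, D}"
      and eX: "\<forall>x\<in>A1. \<forall>y\<in>V - A1. g x y = e \<longrightarrow> y \<in> X"
      using colour_in_one_block[OF multi(2) Q V multi(1)] by blast
    have "finite X" "card X \<le> 3" using X sizes by (auto intro: card_ge_0_finite)
    moreover have "nbhd V g e u \<subseteq> X" if "u \<in> A1" for u
    proof
      fix w assume "w \<in> nbhd V g e u"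
      then have w: "w \<in> V" "w \<noteq> u" "g u w = e" by (auto simp: nbhd_def)
      then have "w \<notin> A1" using inA[OF that, of w] e by auto
      then show "w \<in> X" using eX that w by blast
    qed
    \<comment> \<open>The edge \<open>xy\<close> has colour \<open>c\<close>, not \<open>e\<close>,
      yet a block of three vertices contains both \<open>e\<close>-neighbourhoods.\<close>
    then have "nbhd V g e x \<union> nbhd V g e y \<subseteq> X" using xy by blast
    ultimately have "card (nbhd V g e x \<union> nbhd V g e y) \<le> 3" using card_mono le_trans by metis
    moreover have "card (nbhd V g e x \<union> nbhd V g e y) \<ge> 4"
      using large[of e x y] e xy inA[of x y] V by auto
    ultimately show False by simp
  qed
qed

section \<open>Books in complete graphs\<close>

lemma two_subsets_singleton: "two_subsets {a} = {}"
proof -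
  have False if "e \<subseteq> {a}" "card e = 2" for e
    using card_mono[OF _ that(1)] that(2) by simp
  then show ?thesis by (auto simp: two_subsets_def)
qed

lemma two_subsets_2: "two_subsets {..<2::nat} = {{0, 1}}"
proof -
  have "e = {0, 1}" if "e \<subseteq> {..<2::nat}" "card e = 2" for e
  proof -
    have "e = {..<2}" using that by (intro card_subset_eq) auto
    then show ?thesis by auto
  qed
  moreover have "{0, 1} \<subseteq> {..<2::nat}" "card {0, 1::nat} = 2" by auto
  ultimately show ?thesis unfolding two_subsets_def by blast
qed

lemma verts_book: "verts (book n) = {Inl 0, Inl 1} \<union> (\<lambda>i. Inr (i, 0)) ` {..<n}"
proof -
  have "{..<1::nat} = {0}" "{..<2::nat} = {0, 1}" by auto
  then show ?thesis by (auto simp: book_def graph_join_def copies_def complete_def)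
qed

lemma edges_book:
  "edges (book n) = insert {Inl 0, Inl 1} {{Inl u, Inr (i, 0)} |u i. u < 2 \<and> i < n}"
proof -
  have "{..<1::nat} = {0}" by auto
  then show ?thesis
    by (auto simp: book_def graph_join_def copies_def complete_def two_subsets_singleton two_subsets_2)
qed

lemma doubleton_mem_edges_complete:
  "{x, y} \<in> edges (complete p) \<longleftrightarrow> x < p \<and> y < p \<and> x \<noteq> y"
  by (auto simp: complete_def two_subsets_def card_2_iff doubleton_eq_iff)

text \<open>Using at most two of three colours means missing some \<open>c\<close>. This replaces
  the search for subgraphs by a count of common neighbours in both bounds.\<close>

lemma ex_book_iff:
  assumes f: "coloring 3 p f"
  shows "(\<exists>H. subgraph H (complete p) \<and> isomorphic (book n) H \<and> card (f ` edges H) \<le> 2) \<longleftrightarrow>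
    (\<exists>c\<in>{1, 2, 3}. \<exists>x<p. \<exists>y<p. x \<noteq> y \<and> f {x, y} \<noteq> c \<and>
      n \<le> card {z. z < p \<and> z \<noteq> x \<and> z \<noteq> y \<and> f {x, z} \<noteq> c \<and> f {y, z} \<noteq> c})"
    (is "?L \<longleftrightarrow> ?R")
proof
  assume ?L
  then obtain H \<phi> where H: "subgraph H (complete p)" and few: "card (f ` edges H) \<le> 2"
    and bij: "bij_betw \<phi> (verts (book n)) (verts H)"
    and iso: "\<forall>u\<in>verts (book n). \<forall>v\<in>verts (book n). {u, v} \<in> edges (book n) \<longleftrightarrow> {\<phi> u, \<phi> v} \<in> edges H"
    unfolding isomorphic_def by blast
  have EH: "edges H \<subseteq> edges (complete p)" using H by (simp add: subgraph_def)
  have fH: "f ` edges H \<subseteq> {1, 2, 3}"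
  proof -
    have "f e \<in> {1..3}" if "e \<in> edges H" for e
      using f EH that by (auto simp: coloring_def)
    moreover have "{1..3} = {1, 2, 3::nat}" by auto
    ultimately show ?thesis by blast
  qed
  have "card {1, 2, 3::nat} = 3" by simp
  then have "f ` edges H \<noteq> {1, 2, 3}" using few by auto
  then obtain c where c: "c \<in> {1, 2, 3}" "c \<notin> f ` edges H" using fH by blast
  define x y where "x = \<phi> (Inl 0)" and "y = \<phi> (Inl 1)"
  define h where "h i = \<phi> (Inr (i, 0))" for i
  have E: "{\<phi> u, \<phi> v} \<in> edges H" if "{u, v} \<in> edges (book n)" "u \<in> verts (book n)" "v \<in> verts (book n)" for u v
    using that iso by blast
  have xy: "{x, y} \<in> edges H"
    unfolding x_def y_def by (rule E) (auto simp: verts_book edges_book)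
  have page: "{Inl u, Inr (i, 0)} \<in> edges (book n)" "Inl u \<in> verts (book n)" "Inr (i, 0) \<in> verts (book n)"
    if "i < n" "u < 2" for u i
    using that unfolding edges_book verts_book by (blast, auto)
  have xh: "{x, h i} \<in> edges H" if "i < n" for i
    unfolding x_def h_def by (intro E page[where u = 0 and i = i] that) simp_all
  have yh: "{y, h i} \<in> edges H" if "i < n" for i
    unfolding y_def h_def by (intro E page[where u = 1 and i = i] that) simp_all
  have edge: "u < p \<and> v < p \<and> u \<noteq> v \<and> f {u, v} \<noteq> c" if "{u, v} \<in> edges H" for u v
    using that EH c(2) doubleton_mem_edges_complete by blast
  have "inj_on h {..<n}"
  proof (rule inj_onI)
    fix i j assume "i \<in> {..<n}" "j \<in> {..<n}" "h i = h j"
    then show "i = j"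
      using inj_onD[OF bij_betw_imp_inj_on[OF bij], of "Inr (i, 0)" "Inr (j, 0)"]
      by (auto simp: h_def verts_book)
  qed
  then have "n = card (h ` {..<n})" by (simp add: card_image)
  also have "\<dots> \<le> card {z. z < p \<and> z \<noteq> x \<and> z \<noteq> y \<and> f {x, z} \<noteq> c \<and> f {y, z} \<noteq> c}"
    using edge[OF xh] edge[OF yh] by (intro card_mono) auto
  finally show ?R using c(1) edge[OF xy] by blast
next
  assume ?R
  then obtain c x y where c: "c \<in> {1, 2, 3}" and xy: "x < p" "y < p" "x \<noteq> y" "f {x, y} \<noteq> c"
    and n: "n \<le> card {z. z < p \<and> z \<noteq> x \<and> z \<noteq> y \<and> f {x, z} \<noteq> c \<and> f {y, z} \<noteq> c}" by blast
  \<comment> \<open>Surplus candidates are dropped, since the isomorphism needs exactly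
    \<open>n\<close> pages.\<close>
  obtain Z where Z: "Z \<subseteq> {z. z < p \<and> z \<noteq> x \<and> z \<noteq> y \<and> f {x, z} \<noteq> c \<and> f {y, z} \<noteq> c}"
    "card Z = n" "finite Z" by (rule obtain_subset_with_card_n[OF n])
  then obtain h where h: "bij_betw h {..<n} Z"
    using ex_bij_betw_nat_finite[of Z] by (auto simp: atLeast0LessThan)
  define \<phi> :: "nat + nat \<times> nat \<Rightarrow> nat"
    where "\<phi> = case_sum (\<lambda>u. if u = 0 then x else y) (\<lambda>v. h (fst v))"
  have \<phi>: "\<phi> (Inl 0) = x" "\<phi> (Inl 1) = y" "\<phi> (Inl (Suc 0)) = y" "\<phi> (Inr (i, j)) = h i" for i j
    by (simp_all add: \<phi>_def)
  have hZ: "h i < p" "h i \<noteq> x" "h i \<noteq> y" "f {x, h i} \<noteq> c" "f {y, h i} \<noteq> c" if "i < n" for i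
    using Z(1) bij_betw_apply[OF h, of i] that by auto
  have inj: "inj_on \<phi> (verts (book n))"
    using hZ xy bij_betw_imp_inj_on[OF h] hZ(2,3)[symmetric]
    by (auto simp: inj_on_def verts_book \<phi>)
  have im: "((`) \<phi>) ` edges (book n) =
      insert {x, y} ({{x, h i} |i. i < n} \<union> {{y, h i} |i. i < n})" (is "_ = ?E")
  proof -
    have "{{Inl u, Inr (i, 0)} |u i. u < 2 \<and> i < n} =
      {{Inl (0::nat), Inr (i, 0::nat)} |i. i < n} \<union> {{Inl 1, Inr (i, 0)} |i. i < n}"
      by (auto simp: less_2_cases_iff)
    then show ?thesis unfolding edges_book
      by (simp add: image_Un setcompr_eq_image image_image \<phi>)
  qed
  \<comment> \<open>Edges between pages are left out, because an isomorphism must also preserve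
    non-edges.\<close>
  define H where "H = \<lparr>verts = \<phi> ` verts (book n), edges = ?E\<rparr>"
  have vH: "verts H = {x, y} \<union> h ` {..<n}" by (auto simp: H_def verts_book \<phi> image_Un image_image)
  have "edges H \<subseteq> two_subsets (verts H)"
    using hZ xy hZ(2,3)[symmetric] unfolding vH by (auto simp: H_def two_subsets_def)
  moreover have "verts H \<subseteq> {..<p}" using hZ(1) xy vH by auto
  moreover have "edges H \<subseteq> edges (complete p)"
    using calculation by (auto simp: complete_def two_subsets_def)
  ultimately have sub: "subgraph H (complete p)"
    by (simp add: subgraph_def simple_graph_def complete_def)
  have "isomorphic (book n) H" unfolding isomorphic_def
  proof (intro exI[of _ \<phi>] conjI ballI)
    show "bij_betw \<phi> (verts (book n)) (verts H)" using inj by (simp add: bij_betw_def H_def)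
    fix u v assume uv: "u \<in> verts (book n)" "v \<in> verts (book n)"
    have "e \<subseteq> verts (book n)" if "e \<in> edges (book n)" for e
      using that by (auto simp: edges_book verts_book less_2_cases_iff)
    then have "{u, v} \<in> edges (book n) \<longleftrightarrow> \<phi> ` {u, v} \<in> ((`) \<phi>) ` edges (book n)"
      using uv by (subst inj_on_image_mem_iff[OF inj_on_image_Pow[OF inj]]) auto
    then show "{u, v} \<in> edges (book n) \<longleftrightarrow> {\<phi> u, \<phi> v} \<in> edges H"
      unfolding im by (simp add: H_def)
  qed
  moreover have "card (f ` edges H) \<le> 2"
  proof -
    have "f e \<in> {1, 2, 3}" if "e \<in> edges H" for e
    proof -
      have "f e \<in> {1..3}" using that f sub by (auto simp: coloring_def subgraph_def)
      then show ?thesis by auto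
    qed
    moreover have "f e \<noteq> c" if "e \<in> edges H" for e
      using that xy(4) hZ(4,5) by (auto simp: H_def)
    ultimately have "f ` edges H \<subseteq> {1, 2, 3} - {c}" by blast
    then have "card (f ` edges H) \<le> card ({1, 2, 3} - {c})" by (intro card_mono) auto
    also have "\<dots> = 2" using c by auto
    finally show ?thesis .
  qed
  ultimately show ?L using sub by blast
qed

section \<open>Lower bound\<close>

text \<open>Blow up each vertex of the 2-coloured pentagon (colours 2 and 3) to an edge of colour 1,
  where \<open>i\<close> and \<open>i + 5\<close> form one pair, and join vertex 10 to everything in colour 1.\<close>
definition pentagon_col :: "nat \<Rightarrow> nat \<Rightarrow> nat" where
  "pentagon_col x y = (if x = 10 \<or> y = 10 \<or> x mod 5 = y mod 5 then 1
     else if (x + 1) mod 5 = y mod 5 \<or> (y + 1) mod 5 = x mod 5 then 2 else 3)"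

lemma pentagon_col_sym: "pentagon_col x y = pentagon_col y x"
  by (auto simp: pentagon_col_def)

text \<open>Makes bounded quantifiers executable for the two finite checks.\<close>

lemma all_less_iff: "(\<forall>x<n. P x) \<longleftrightarrow> list_all P [0..<n]"
  by (auto simp: list_all_iff)

text \<open>The vertices of a pair see any third vertex in the same colour, three different pairs
  span only two colours, and vertex 10 gives two edges of colour 1.\<close>

lemma pentagon_col_no_rainbow:
  "\<forall>x<11. \<forall>y<11. \<forall>z<11. distinct [x, y, z] \<longrightarrow>
     \<not> distinct [pentagon_col x y, pentagon_col x z, pentagon_col y z]"
  unfolding all_less_iff by code_simp

text \<open>For \<open>c = 1\<close> the candidates are the six vertices of the other three pairs;
  for \<open>c = 2\<close> and \<open>c = 3\<close> at most five remain.\<close>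

lemma pentagon_col_no_book:
  "\<forall>c\<in>set [1, 2, 3]. \<forall>x<11. \<forall>y<11. x \<noteq> y \<longrightarrow> pentagon_col x y \<noteq> c \<longrightarrow>
     length (filter (\<lambda>z. z \<noteq> x \<and> z \<noteq> y \<and> pentagon_col x z \<noteq> c \<and> pentagon_col y z \<noteq> c) [0..<11]) \<le> 6"
  unfolding all_less_iff by code_simp

text \<open>Covers every \<open>p \<le> 11\<close>, since minimality of 12 requires each smaller
  order to fail. \<open>Min\<close> and \<open>Max\<close> recover the ends of an edge.\<close>

lemma coloring_11_without_book:
  defines "f \<equiv> \<lambda>e. pentagon_col (Min e) (Max e)"
  assumes "p \<le> 11"
  shows "gallai_coloring 3 p f"
    and "\<not> (\<exists>H. subgraph H (complete p) \<and> isomorphic (book 7) H \<and> card (f ` edges H) \<le> 2)"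
proof -
  have f: "f {x, y} = pentagon_col x y" for x y
    using pentagon_col_sym[of x y] by (cases "x \<le> y") (auto simp: f_def min_def max_def)
  have col: "coloring 3 p f" by (auto simp: coloring_def f_def pentagon_col_def)
  moreover have "\<not> rainbow_triangle p f x y z" for x y z
  proof -
    have "x < 11 \<and> y < 11 \<and> z < 11" if "{x, y, z} \<subseteq> verts (complete p)"
      using that assms(2) by (auto simp: complete_def)
    then show ?thesis using pentagon_col_no_rainbow unfolding rainbow_triangle_def f by blast
  qed
  ultimately show "gallai_coloring 3 p f" by (simp add: gallai_coloring_def)
  have False
    if "c \<in> {1, 2, 3}" "x < p" "y < p" "x \<noteq> y" "f {x, y} \<noteq> c"
      "7 \<le> card {z. z < p \<and> z \<noteq> x \<and> z \<noteq> y \<and> f {x, z} \<noteq> c \<and> f {y, z} \<noteq> c}" for c x y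
  proof -
    let ?zs = "filter (\<lambda>z. z \<noteq> x \<and> z \<noteq> y \<and> pentagon_col x z \<noteq> c \<and> pentagon_col y z \<noteq> c) [0..<11]"
    have "card {z. z < p \<and> z \<noteq> x \<and> z \<noteq> y \<and> f {x, z} \<noteq> c \<and> f {y, z} \<noteq> c} \<le> card (set ?zs)"
      using assms(2) by (intro card_mono) (auto simp: f)
    also have "\<dots> \<le> length ?zs" by (rule card_length)
    also have "\<dots> \<le> 6"
    proof -
      have "c \<in> set [1, 2, 3]" "x < 11" "y < 11" "pentagon_col x y \<noteq> c" using that assms(2) f by auto
      then show ?thesis using pentagon_col_no_book that(4) by blast
    qed
    finally show False using that(6) by simp
  qed
  then show "\<not> (\<exists>H. subgraph H (complete p) \<and> isomorphic (book 7) H \<and> card (f ` edges H) \<le> 2)"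
    unfolding ex_book_iff[OF col] by blast
qed

section \<open>The two bounds combined\<close>

lemma coloring_12_has_book:
  assumes "gallai_coloring 3 12 f"
  shows "\<exists>H. subgraph H (complete 12) \<and> isomorphic (book 7) H \<and> card (f ` edges H) \<le> 2"
proof -
  let ?V = "{..<12::nat}" and ?g = "\<lambda>x y. f {x, y}"
  have col: "coloring 3 12 f" and nr: "\<And>x y z. \<not> rainbow_triangle 12 f x y z"
    using assms by (auto simp: gallai_coloring_def)
  have "gallai3 ?V ?g"
  proof
    show "f {x, y} = f {y, x}" for x y by (simp add: insert_commute)
    show "f {x, y} \<in> {1, 2, 3}" if "x \<in> ?V" "y \<in> ?V" "x \<noteq> y" for x y
    proof -
      have "f {x, y} \<in> {1..3}"
        using that col doubleton_mem_edges_complete[of x y 12] unfolding coloring_def by blast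
      then show ?thesis by auto
    qed
    show "f {x, y} = f {x, z} \<or> f {x, y} = f {y, z} \<or> f {x, z} = f {y, z}"
      if "x \<in> ?V" "y \<in> ?V" "z \<in> ?V" "distinct [x, y, z]" for x y z
      using nr[of x y z] that by (auto simp: rainbow_triangle_def complete_def)
  qed simp
  then obtain c x y where c: "c \<in> {1, 2, 3}" and xy: "x \<in> ?V" "y \<in> ?V" "x \<noteq> y" "f {x, y} \<noteq> c"
    and few: "card (nbhd ?V ?g c x \<union> nbhd ?V ?g c y) \<le> 3"
    using gallai3_12[of ?V ?g] by auto
  let ?N = "nbhd ?V ?g c x \<union> nbhd ?V ?g c y"
  have "card (?V - {x, y} - ?N) \<ge> card (?V - {x, y}) - card ?N"
    by (intro diff_card_le_card_Diff) (simp add: finite_nbhd)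
  moreover have "card (?V - {x, y}) = 10" using xy by (simp add: card_Diff_subset)
  moreover have "?V - {x, y} - ?N \<subseteq> {z. z < 12 \<and> z \<noteq> x \<and> z \<noteq> y \<and> f {x, z} \<noteq> c \<and> f {y, z} \<noteq> c}"
    by (auto simp: nbhd_def)
  then have "card (?V - {x, y} - ?N) \<le> card {z. z < 12 \<and> z \<noteq> x \<and> z \<noteq> y \<and> f {x, z} \<noteq> c \<and> f {y, z} \<noteq> c}"
    by (intro card_mono) auto
  ultimately have "7 \<le> card {z. z < 12 \<and> z \<noteq> x \<and> z \<noteq> y \<and> f {x, z} \<noteq> c \<and> f {y, z} \<noteq> c}"
    using few by linarith
  then show ?thesis unfolding ex_book_iff[OF col] using c xy by blast
qed

theorem theorem4p3: "gr 3 2 (book 7) = 12"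
  unfolding gr_def
proof (rule Least_equality)
  show "\<forall>f. gallai_coloring 3 12 f \<longrightarrow>
      (\<exists>H. subgraph H (complete 12) \<and> isomorphic (book 7) H \<and> card (f ` edges H) \<le> 2)"
    using coloring_12_has_book by blast
next
  fix p
  assume "\<forall>f. gallai_coloring 3 p f \<longrightarrow>
      (\<exists>H. subgraph H (complete p) \<and> isomorphic (book 7) H \<and> card (f ` edges H) \<le> 2)"
  then show "12 \<le> p" using coloring_11_without_book[of p] by (cases "p \<le> 11") auto
qed

end
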